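(* Let $X$ be a real normed space and let $\mathcal C,\mathcal K\subset X$ be co-radiant sets such that $d_{\mathcal C}d_{\mathcal K}>0$, $\mathcal K$ is regular, $\operatorname{cl\,co}(\mathcal C)\cap\operatorname{int}(\mathcal K)\ne\varnothing$, and $(\operatorname{cone}(\mathcal C),\operatorname{cone}(\mathcal K))$ verifies the SSP. Let $0<\alpha_1<\alpha_2<1$, $f\in S_{X^*}$, $\lambda>0$ and $\eta_0>0$ be such that, for every $0<\theta<1$, every $\eta\in(0,\theta\eta_0)$ and every $\alpha\in(\alpha_1,\alpha_2)$, $$f(y')-\alpha\|y'\|<\lambda\theta<\lambda<f(y)-\alpha\|y\|\qquad\forall y'\in X\setminus\operatorname{int}(\mathcal K(\eta)),\ \forall y\in\operatorname{cl\,co}(\mathcal C).$$ Fix $\alpha\in(\alpha_1,\alpha_2)$ and set $G_\alpha(y):=(\lambda-f(y)+\alpha\|y\|)_+$ and $R_\alpha(y):=\frac{\eta_0}{\lambda}G_\alpha(y)$ for $y\in X$. Let $A\subset X\setminus\{0_X\}$ be nonempty, let $T:A\to X^*$, and for $y\in A$ define $$\Psi_T(y):=\sup_{z\in A}\bigl[\langle T(y),y-z\rangle\bigr]_+,\qquad M_{\alpha,T}(y):=\max\{\Psi_T(y),R_\alpha(y)\}.$$ Let $\varepsilon\ge 0$. If $y\in A$ satisfies $M_{\alpha,T}(y)\le\varepsilon$, then $y$ is an $\varepsilon$-approximate radially feasible solution of the variational inequality. Consequently, if $(y_n)\subset A$ satisfies $M_{\alpha,T}(y_n)\to 0$, then $$\Psi_T(y_n)\to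 0\qquad\text{and}\qquad\bigl(\eta_0-\delta_{\mathcal K}(y_n)\bigr)_+\to 0.$$
   Context: $X$ is a real normed space, $S_X$ its unit sphere, $B_X^\circ$ its open unit ball, $X^*$ its topological dual, $S_{X^*}$ the unit sphere of $X^*$ for the dual norm, $\langle\cdot,\cdot\rangle$ the duality pairing; $\operatorname{cl},\operatorname{int},\operatorname{bd},\operatorname{co}$ denote closure, interior, boundary, convex hull, and $\operatorname{cl\,co}$ the closed convex hull; $t_+=[t]_+:=\max\{t,0\}$. A cone is a nonempty $C\subset X$ with $\alpha C\subset C$ for all $\alpha\ge 0$; cones are assumed nontrivial ($\{0_X\}\subsetneq C\subset X$) unless otherwise stated. $\operatorname{cone}(A):=\{\lambda a:\lambda\ge 0,\ a\in A\}$. Approximate solution: for $\varepsilon\ge 0$, a point $y\in A$ is an $\varepsilon$-approximate radially feasible solution of the variational inequality if $\langle T(y),z-y\rangle\ge-\varepsilon$ for all $z\in A$ and $\delta_{\mathcal K}(y)\ge\eta_0-\varepsilon$. SSP: a pair of cones $(C,K)$ verifies the strict separation property (SSP) if $0_X\notin\operatorname{cl}\bigl(\operatorname{co}(C\cap S_X)-\operatorname{co}((\operatorname{bd}K\cap S_X)\cup\{0_X\})\bigr)$. Co-radiant set: $\mathcal K\subset X$ with $\lambda x\in\mathcal K$ for all $x\in\mathcal K$, $\lambda\ge 1$; co-radiant sets are assumed nonempty with $0_X\notin\mathcal K$. For $\eta>0$, $\mathcal K(\eta):=\eta\mathcal K$. Norm-base: for $t>0$, $\mathcal K\cap tS_X$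 is a norm-base of $\mathcal K$ if for every $x\in\mathcal K$ there exist $y\in\mathcal K\cap tS_X$ and $\lambda>0$ with $x=\lambda y$; $\mathcal K$ admits a norm-base if this holds for some $t>0$. Interior reductions: for a cone $K$ and $\varepsilon>0$, $K^{-\varepsilon}:=K\setminus\bigl(\operatorname{cone}((\operatorname{bd}K\cap S_X)+\varepsilon B_X^\circ)\setminus\{0_X\}\bigr)$. For co-radiant $\mathcal K$, $\mathcal K^{-\varepsilon}:=\mathcal K\cap(\operatorname{cone}(\mathcal K))^{-\varepsilon}$. $\mathcal K$ is regular if, for every $\varepsilon>0$ with $\mathcal K^{-\varepsilon}\neq\varnothing$, the set $\mathcal K^{-\varepsilon}$ admits a norm-base. Radial profile: $\rho_{\mathcal K}:S_X\to[0,+\infty]$, $\rho_{\mathcal K}(v):=\inf\{\lambda>0:\lambda v\in\mathcal K\}$ with $\inf\varnothing=+\infty$; $\operatorname{dom}(\rho_{\mathcal K}):=\{v\in S_X:\rho_{\mathcal K}(v)<+\infty\}$; $d_{\mathcal K}:=\inf_{v\in\operatorname{dom}(\rho_{\mathcal K})}\rho_{\mathcal K}(v)$. Radial depth: $\delta_{\mathcal K}:X\setminus\{0_X\}\to[0,+\infty]$, $\delta_{\mathcal K}(y):=\sup\{\eta>0:\ y\in\mathcal K(\eta)\}$ with $\sup\varnothing=0$. *)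

theory Defs
  imports "HOL-Analysis.Analysis"
begin

text \<open>
  The normed space is the type \<open>'a\<close>; its dual is \<open>'a \<Rightarrow>\<^sub>L real\<close>, whose norm is the dual norm.
  Quantities with values in \<open>[0, \<infinity>]\<close> are \<open>ereal\<close>-valued, so that signed differences such as
  \<open>\<eta>\<^sub>0 - \<delta>\<close> keep their usual meaning.
\<close>

definition cone_of :: "'a::real_vector set \<Rightarrow> 'a set" where
  "cone_of A = {t *\<^sub>R a | t a. 0 \<le> t \<and> a \<in> A}"

lemma cone_of_eq_cone_hull: "cone_of A = cone hull A"
  by (auto simp: cone_of_def cone_hull_expl)

definition nontrivial_cone :: "'a::real_vector set \<Rightarrow> bool" where
  "nontrivial_cone C \<longleftrightarrow> cone C \<and> {0} \<subset> C"

definition strict_separation_property :: "'a::real_normed_vector set \<Rightarrow> 'a set \<Rightarrow> bool" where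
  "strict_separation_property C K \<longleftrightarrow>
     nontrivial_cone C \<and> nontrivial_cone K \<and>
     0 \<notin> closure {x - y | x y. x \<in> convex hull (C \<inter> sphere 0 1) \<and>
                               y \<in> convex hull ((frontier K \<inter> sphere 0 1) \<union> {0})}"

definition co_radiant :: "'a::real_vector set \<Rightarrow> bool" where
  "co_radiant K \<longleftrightarrow> K \<noteq> {} \<and> 0 \<notin> K \<and> (\<forall>x\<in>K. \<forall>t\<ge>1. t *\<^sub>R x \<in> K)"

lemma nontrivial_cone_cone_of:
  assumes "co_radiant K"
  shows "nontrivial_cone (cone_of K)"
proof -
  obtain x where x: "x \<in> K" "x \<noteq> 0"
    using assms unfolding co_radiant_def by blast
  have "x \<in> cone_of K" "0 \<in> cone_of K"
    unfolding cone_of_def using x by (force intro: exI[of _ 1], force intro: exI[of _ 0])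
  then show ?thesis
    using x unfolding nontrivial_cone_def by (auto simp: cone_of_eq_cone_hull cone_cone_hull)
qed

definition dilate :: "'a::real_vector set \<Rightarrow> real \<Rightarrow> 'a set" where
  "dilate K \<eta> = (\<lambda>x. \<eta> *\<^sub>R x) ` K"

definition is_norm_base :: "'a::real_normed_vector set \<Rightarrow> real \<Rightarrow> bool" where
  "is_norm_base K t \<longleftrightarrow> 0 < t \<and> (\<forall>x\<in>K. \<exists>y\<in>K \<inter> sphere 0 t. \<exists>s>0. x = s *\<^sub>R y)"

definition admits_norm_base :: "'a::real_normed_vector set \<Rightarrow> bool" where
  "admits_norm_base K \<longleftrightarrow> (\<exists>t. is_norm_base K t)"

definition cone_reduction :: "'a::real_normed_vector set \<Rightarrow> real \<Rightarrow> 'a set" where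
  "cone_reduction K \<epsilon> =
     K - (cone_of {x + b | x b. x \<in> frontier K \<inter> sphere 0 1 \<and> b \<in> ball 0 \<epsilon>} - {0})"

definition co_radiant_reduction :: "'a::real_normed_vector set \<Rightarrow> real \<Rightarrow> 'a set" where
  "co_radiant_reduction K \<epsilon> = K \<inter> cone_reduction (cone_of K) \<epsilon>"

definition regular_co_radiant :: "'a::real_normed_vector set \<Rightarrow> bool" where
  "regular_co_radiant K \<longleftrightarrow>
     (\<forall>\<epsilon>>0. co_radiant_reduction K \<epsilon> \<noteq> {} \<longrightarrow> admits_norm_base (co_radiant_reduction K \<epsilon>))"

text \<open>The radial profile is meaningful on the unit sphere only; \<open>Inf {} = \<infinity>\<close> in \<open>ereal\<close>.\<close>

definition radial_profile :: "'a::real_normed_vector set \<Rightarrow> 'a \<Rightarrow> ereal" where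
  "radial_profile K v = Inf (ereal ` {t. 0 < t \<and> t *\<^sub>R v \<in> K})"

definition radial_profile_dom :: "'a::real_normed_vector set \<Rightarrow> 'a set" where
  "radial_profile_dom K = {v \<in> sphere 0 1. radial_profile K v < \<infinity>}"

definition radial_distance :: "'a::real_normed_vector set \<Rightarrow> ereal" where
  "radial_distance K = (INF v\<in>radial_profile_dom K. radial_profile K v)"

text \<open>Inserting \<open>0\<close> implements the convention \<open>sup \<emptyset> = 0\<close>. Meaningful for \<open>y \<noteq> 0\<close> only.\<close>

definition radial_depth :: "'a::real_normed_vector set \<Rightarrow> 'a \<Rightarrow> ereal" where
  "radial_depth K y = Sup (insert 0 (ereal ` {\<eta>. 0 < \<eta> \<and> y \<in> dilate K \<eta>}))"

definition approx_radially_feasible_solution ::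
  "'a::real_normed_vector set \<Rightarrow> ('a \<Rightarrow> 'a \<Rightarrow>\<^sub>L real) \<Rightarrow> 'a set \<Rightarrow> real \<Rightarrow> real \<Rightarrow> 'a \<Rightarrow> bool" where
  "approx_radially_feasible_solution A T K \<eta>\<^sub>0 \<epsilon> y \<longleftrightarrow>
     y \<in> A \<and> (\<forall>z\<in>A. blinfun_apply (T y) (z - y) \<ge> - \<epsilon>) \<and> radial_depth K y \<ge> ereal (\<eta>\<^sub>0 - \<epsilon>)"

definition gap_G :: "('a::real_normed_vector \<Rightarrow>\<^sub>L real) \<Rightarrow> real \<Rightarrow> real \<Rightarrow> 'a \<Rightarrow> real" where
  "gap_G f lam \<alpha> y = max (lam - blinfun_apply f y + \<alpha> * norm y) 0"

definition residual_R :: "('a::real_normed_vector \<Rightarrow>\<^sub>L real) \<Rightarrow> real \<Rightarrow> real \<Rightarrow> real \<Rightarrow> 'a \<Rightarrow> real" where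
  "residual_R f lam \<eta>\<^sub>0 \<alpha> y = \<eta>\<^sub>0 / lam * gap_G f lam \<alpha> y"

definition gap_Psi :: "'a::real_normed_vector set \<Rightarrow> ('a \<Rightarrow> 'a \<Rightarrow>\<^sub>L real) \<Rightarrow> 'a \<Rightarrow> ereal" where
  "gap_Psi A T y = (SUP z\<in>A. ereal (max (blinfun_apply (T y) (y - z)) 0))"

definition merit_M ::
  "'a::real_normed_vector set \<Rightarrow> ('a \<Rightarrow> 'a \<Rightarrow>\<^sub>L real) \<Rightarrow> ('a \<Rightarrow>\<^sub>L real) \<Rightarrow> real \<Rightarrow> real \<Rightarrow> real \<Rightarrow> 'a \<Rightarrow> ereal"
  where
  "merit_M A T f lam \<eta>\<^sub>0 \<alpha> y = max (gap_Psi A T y) (ereal (residual_R f lam \<eta>\<^sub>0 \<alpha> y))"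

end

theory Submission
  imports Defs
begin

text \<open>
  The nonlinear separation inequality contains a quantitative error bound for the radial depth. Put
  \<open>\<phi>(y) = f(y) - \<alpha> \<parallel>y\<parallel>\<close>. The separation says that the superlevel set \<open>{\<phi> \<ge> \<lambda>\<theta>}\<close> lies in
  \<open>int(K(\<eta>))\<close> whenever \<open>0 < \<eta> < \<theta>\<eta>\<^sub>0\<close> and \<open>0 < \<theta> < 1\<close>: the fraction \<open>\<theta>\<close> of the level \<open>\<lambda>\<close> that
  \<open>\<phi>(y)\<close> reaches guarantees, up to arbitrarily little, the same fraction of the target depth \<open>\<eta>\<^sub>0\<close>.
  The residual \<open>R(y)\<close> is the amount by which \<open>\<phi>(y)\<close> falls short of \<open>\<lambda>\<close> (zero if it does not),
  rescaled by \<open>\<eta>\<^sub>0/\<lambda>\<close>, so this reads \<open>\<delta>\<^sub>K(y) \<ge> \<eta>\<^sub>0 - R(y)\<close> for every \<open>y\<close>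
  (lemma \<open>radial_depth_ge_residual\<close>).

  A bound \<open>M(y) \<le> \<epsilon>\<close> on the merit function bounds both \<open>\<Psi>(y)\<close> and \<open>R(y)\<close>: the former is the
  approximate variational inequality, the latter is the approximate feasibility by the error bound.
  For the sequential statement the same two estimates squeeze \<open>\<Psi>(y\<^sub>n)\<close> and \<open>[\<eta>\<^sub>0 - \<delta>\<^sub>K(y\<^sub>n)]\<^sub>+\<close>
  between \<open>0\<close> and \<open>M(y\<^sub>n)\<close>.
\<close>

lemma radial_depth_nonneg: "0 \<le> radial_depth K y"
  unfolding radial_depth_def by (rule Sup_upper) simp

lemma radial_depth_ge_dilation:
  assumes "0 < \<eta>" and "y \<in> dilate K \<eta>"
  shows "ereal \<eta> \<le> radial_depth K y"
  unfolding radial_depth_def using assms by (intro Sup_upper) auto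

text \<open>
  With \<open>\<phi>(y) = f(y) - \<alpha> \<parallel>y\<parallel>\<close>: if \<open>0 < \<eta> < \<eta>\<^sub>0 - R(y)\<close>, any \<open>\<theta>\<close> strictly between \<open>\<eta>/\<eta>\<^sub>0\<close> and
  \<open>1 - R(y)/\<eta>\<^sub>0\<close> satisfies \<open>\<lambda>\<theta> \<le> \<phi>(y)\<close> and \<open>\<eta> < \<theta>\<eta>\<^sub>0\<close>, which is incompatible with \<open>y\<close> lying
  outside \<open>int(K(\<eta>))\<close>. Hence \<open>y \<in> K(\<eta>)\<close> for all such \<open>\<eta>\<close>, and letting \<open>\<eta>\<close> increase to
  \<open>\<eta>\<^sub>0 - R(y)\<close> gives the bound. If \<open>R(y) \<ge> \<eta>\<^sub>0\<close>, it holds because the depth is nonnegative.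
\<close>

lemma radial_depth_ge_residual:
  fixes K :: "'a::real_normed_vector set" and f :: "'a \<Rightarrow>\<^sub>L real"
  assumes lam: "0 < lam" and \<eta>0: "0 < \<eta>\<^sub>0"
    and separation: "\<And>\<theta> \<eta> y'. \<lbrakk>0 < \<theta>; \<theta> < 1; 0 < \<eta>; \<eta> < \<theta> * \<eta>\<^sub>0; y' \<notin> interior (dilate K \<eta>)\<rbrakk>
      \<Longrightarrow> blinfun_apply f y' - \<alpha> * norm y' < lam * \<theta>"
  shows "ereal (\<eta>\<^sub>0 - residual_R f lam \<eta>\<^sub>0 \<alpha> y) \<le> radial_depth K y"
proof (rule dense_le)
  fix x :: ereal
  assume x: "x < ereal (\<eta>\<^sub>0 - residual_R f lam \<eta>\<^sub>0 \<alpha> y)"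
  define G where "G = gap_G f lam \<alpha> y"
  have G: "0 \<le> G" "lam - G \<le> blinfun_apply f y - \<alpha> * norm y"
    unfolding G_def gap_G_def by auto
  show "x \<le> radial_depth K y"
  proof (cases "x \<le> 0")
    case True
    then show ?thesis
      using radial_depth_nonneg order_trans by blast
  next
    case False
    with x obtain \<eta> where \<eta>: "x = ereal \<eta>" "0 < \<eta>"
      by (cases x) auto
    have "\<eta> < \<eta>\<^sub>0 * (1 - G / lam)"
      using x \<eta> by (simp add: residual_R_def G_def algebra_simps)
    then have "\<eta> / \<eta>\<^sub>0 < 1 - G / lam"
      using \<eta>0 by (simp add: field_simps)
    then obtain \<theta> where \<theta>: "\<eta> / \<eta>\<^sub>0 < \<theta>" "\<theta> < 1 - G / lam"
      using dense by blast
    have "0 < \<eta> / \<eta>\<^sub>0" "0 \<le> G / lam"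
      using \<eta> \<eta>0 lam G by simp_all
    then have \<theta>01: "0 < \<theta>" "\<theta> < 1"
      using \<theta> by linarith+
    have "\<eta> < \<theta> * \<eta>\<^sub>0"
      using \<theta>(1) \<eta>0 by (simp add: field_simps)
    moreover have "lam * \<theta> \<le> lam - G"
      using \<theta>(2) lam by (simp add: field_simps)
    ultimately have "y \<in> interior (dilate K \<eta>)"
      using separation[of \<theta> \<eta> y] \<theta>01 \<eta>(2) G(2) by fastforce
    then have "y \<in> dilate K \<eta>"
      using interior_subset by blast
    then show ?thesis
      using radial_depth_ge_dilation \<eta> by blast
  qed
qed

lemma gap_Psi_upper:
  assumes "z \<in> A"
  shows "ereal (max (blinfun_apply (T y) (y - z)) 0) \<le> gap_Psi A T y"
  unfolding gap_Psi_def using assms by (rule SUP_upper)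

lemma gap_Psi_nonneg:
  assumes "A \<noteq> {}"
  shows "0 \<le> gap_Psi A T y"
proof -
  obtain z where "z \<in> A"
    using assms by blast
  then have "ereal (max (blinfun_apply (T y) (y - z)) 0) \<le> gap_Psi A T y"
    by (rule gap_Psi_upper)
  moreover have "0 \<le> ereal (max (blinfun_apply (T y) (y - z)) 0)"
    by (simp add: le_max_iff_disj)
  ultimately show ?thesis
    by (rule order_trans[rotated])
qed

theorem corollary7p12:
  fixes C K A :: "'a::real_normed_vector set"
    and f :: "'a \<Rightarrow>\<^sub>L real"
    and T :: "'a \<Rightarrow> 'a \<Rightarrow>\<^sub>L real"
    and \<alpha>\<^sub>1 \<alpha>\<^sub>2 lam \<eta>\<^sub>0 \<alpha> :: real
  assumes "co_radiant C" and "co_radiant K"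
    and "radial_distance C * radial_distance K > 0"
    and "regular_co_radiant K"
    and "closure (convex hull C) \<inter> interior K \<noteq> {}"
    and "strict_separation_property (cone_of C) (cone_of K)"
    and "0 < \<alpha>\<^sub>1" and "\<alpha>\<^sub>1 < \<alpha>\<^sub>2" and "\<alpha>\<^sub>2 < 1"
    and "norm f = 1" and "lam > 0" and "\<eta>\<^sub>0 > 0"
    and "\<forall>\<theta>\<in>{0<..<1}. \<forall>\<eta>\<in>{0<..<\<theta> * \<eta>\<^sub>0}. \<forall>\<beta>\<in>{\<alpha>\<^sub>1<..<\<alpha>\<^sub>2}.
           \<forall>y'\<in>- interior (dilate K \<eta>). \<forall>y\<in>closure (convex hull C).
             blinfun_apply f y' - \<beta> * norm y' < lam * \<theta> \<and> lam * \<theta> < lam \<and>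
             lam < blinfun_apply f y - \<beta> * norm y"
    and "\<alpha> \<in> {\<alpha>\<^sub>1<..<\<alpha>\<^sub>2}"
    and "A \<noteq> {}" and "A \<subseteq> - {0}"
  shows "(\<forall>\<epsilon>\<ge>0. \<forall>y\<in>A. merit_M A T f lam \<eta>\<^sub>0 \<alpha> y \<le> ereal \<epsilon> \<longrightarrow>
            approx_radially_feasible_solution A T K \<eta>\<^sub>0 \<epsilon> y) \<and>
         (\<forall>ys :: nat \<Rightarrow> 'a. (\<forall>n. ys n \<in> A) \<longrightarrow>
            (\<lambda>n. merit_M A T f lam \<eta>\<^sub>0 \<alpha> (ys n)) \<longlonglongrightarrow> 0 \<longrightarrow>
            (\<lambda>n. gap_Psi A T (ys n)) \<longlonglongrightarrow> 0 \<and>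
            (\<lambda>n. max (ereal \<eta>\<^sub>0 - radial_depth K (ys n)) 0) \<longlonglongrightarrow> 0)"
proof -
  let ?M = "merit_M A T f lam \<eta>\<^sub>0 \<alpha>"
  let ?R = "residual_R f lam \<eta>\<^sub>0 \<alpha>"
  \<comment> \<open>The upper bound outside \<open>int(K(\<eta>))\<close> is quantified over \<open>cl co(C)\<close> too, so a point of it is needed.\<close>
  obtain c where c: "c \<in> closure (convex hull C)"
    using assms(5) by blast
  have separation: "blinfun_apply f y' - \<alpha> * norm y' < lam * \<theta>"
    if "0 < \<theta>" "\<theta> < 1" "0 < \<eta>" "\<eta> < \<theta> * \<eta>\<^sub>0" "y' \<notin> interior (dilate K \<eta>)" for \<theta> \<eta> y'
    using assms(13)[rule_format, of \<theta> \<eta> \<alpha> y' c] that c assms(14) by simp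
  have depth: "ereal (\<eta>\<^sub>0 - ?R y) \<le> radial_depth K y" for y
    using radial_depth_ge_residual[OF assms(11,12) separation] .
  have "approx_radially_feasible_solution A T K \<eta>\<^sub>0 \<epsilon> y" if "y \<in> A" and M: "?M y \<le> ereal \<epsilon>" for \<epsilon> y
  proof -
    have Psi: "gap_Psi A T y \<le> ereal \<epsilon>" and R: "?R y \<le> \<epsilon>"
      using M by (auto simp: merit_M_def)
    have "- \<epsilon> \<le> blinfun_apply (T y) (z - y)" if "z \<in> A" for z
    proof -
      have "blinfun_apply (T y) (y - z) \<le> \<epsilon>"
        using order_trans[OF gap_Psi_upper[OF that, of T y] Psi] by simp
      then show ?thesis
        by (simp add: blinfun.diff_right)
    qed
    moreover have "ereal (\<eta>\<^sub>0 - \<epsilon>) \<le> radial_depth K y"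
      using R by (intro order_trans[OF _ depth]) simp
    ultimately show ?thesis
      using \<open>y \<in> A\<close> by (simp add: approx_radially_feasible_solution_def)
  qed
  moreover have "(\<lambda>n. gap_Psi A T (ys n)) \<longlonglongrightarrow> 0 \<and>
      (\<lambda>n. max (ereal \<eta>\<^sub>0 - radial_depth K (ys n)) 0) \<longlonglongrightarrow> 0"
    if lim: "(\<lambda>n. ?M (ys n)) \<longlonglongrightarrow> 0" for ys :: "nat \<Rightarrow> 'a"
  proof
    show "(\<lambda>n. gap_Psi A T (ys n)) \<longlonglongrightarrow> 0"
      by (rule tendsto_sandwich[OF _ _ tendsto_const lim])
        (simp_all add: gap_Psi_nonneg[OF assms(15)] merit_M_def)
    have "max (ereal \<eta>\<^sub>0 - radial_depth K y) 0 \<le> ?M y" for y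
    proof -
      have "ereal \<eta>\<^sub>0 - radial_depth K y \<le> ereal (?R y)"
        using depth[of y] by (cases "radial_depth K y") auto
      then show ?thesis
        using gap_Psi_nonneg[OF assms(15), of T y] unfolding merit_M_def
        by (intro max.boundedI max.coboundedI2[of "ereal \<eta>\<^sub>0 - _"] max.coboundedI1[of 0])
    qed
    then show "(\<lambda>n. max (ereal \<eta>\<^sub>0 - radial_depth K (ys n)) 0) \<longlonglongrightarrow> 0"
      by (intro tendsto_sandwich[OF _ _ tendsto_const lim]) simp_all
  qed
  ultimately show ?thesis
    by blast
qed

end
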